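(* Let $X$ be an infinite locally compact Hausdorff space admitting a countable basis $\mathcal B$ of compact open sets closed under finite intersections, and let $W_0$ be the associated compactified word space (defined in the context). Let $(x^n)_{n\in\mathbb N}$ be a sequence in $W_0$, where each $x^n=x^n_1x^n_2\cdots$, and let $x=x_1x_2\cdots\in W_0$. (a) Suppose $\ell(x)=k<\infty$. Then $\lim_{n\to\infty}x^n=x$ if and only if: there exists $N\in\mathbb N$ such that $\ell(x^n)\ge k$ for all $n\ge N$; for each $i\in\{1,\dots,k\}$ the sequence $(x^n_i)_{n:\,\ell(x^n)\ge i}$ converges to $x_i$ in $X$; and, in case there are infinitely many $n$ with $\ell(x^n)\ge k+1$, the sequence $(x^n_{k+1})_{n:\,\ell(x^n)\ge k+1}$ converges to $\infty$ in $X_\infty$. (b) If $\ell(x)=\infty$, then $\lim_{n\to\infty}x^n=x$ if and only if $\ell(x^n)\to\infty$ and $(x^n_i)_{n:\,\ell(x^n)\ge i}\to x_i$ in $X$ for each $i\in\mathbb N$.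
   Context: $\mathbb N=\{1,2,\dots\}$. $W_0=X^{\mathbb N}\cup\bigcup_{n\ge0}X^n$ with $X^0=\{\vec 0\}$ (empty word); elements are words $x=x_1x_2\cdots$ with length $\ell(x)\in\{0,1,2,\dots\}\cup\{\infty\}$. $X_\infty=X\cup\{\infty\}$ is the one-point compactification of $X$. Let $Q:X_\infty^{\mathbb N}\to W_0$ send $(x_1,x_2,\dots)$ to the infinite word $x_1x_2\cdots$ if all $x_i\ne\infty$, to $x_1\cdots x_n$ if $x_{n+1}=\infty$ and $x_i\neq\infty$ for $1\le i\le n$, and to $\vec 0$ if $x_1=\infty$. $W_0$ carries the quotient topology induced by $Q$ from the product topology; equivalently, the topology generated by the generalized cylinders $Z[B_1\times\cdots\times B_k,K]=\{x\in W_0:\ell(x)\ge k,\ x_i\in B_i\ (1\le i\le k),\ x_{k+1}\notin K\}$ (last condition vacuous if $\ell(x)=k$) and $C[K]=\{x\in W_0:x=\vec 0\text{ or }x_1\notin K\}$, with $k\in\mathbb N$, $B_i\in\mathcal B$, $K\subseteq X$ compact open. For fixed $i$, $(x^n_i)_{n:\,\ell(x^n)\ge i}$ denotes the sequence in $X$ consisting of the $i$-th coordinates of those $x^n$ whose length is at least $i$. *)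

theory Defs
  imports "HOL-Analysis.Analysis"
begin

text \<open>
  Words over an alphabet, finite or infinite. The function in \<open>InfWord f\<close> is indexed from 0:
  the word is \<open>f 0, f 1, f 2, \<dots>\<close>. In contrast, \<open>letter w i\<close> counts from 1:
  \<open>letter w i\<close> is $w_i$, meaningful only for $1 \le i \le \ell(w)$.
\<close>

datatype 'a gword = FinWord "'a list" | InfWord "nat \<Rightarrow> 'a"

fun wlength :: "'a gword \<Rightarrow> enat" where
  "wlength (FinWord us) = enat (length us)"
| "wlength (InfWord f) = \<infinity>"

fun letter :: "'a gword \<Rightarrow> nat \<Rightarrow> 'a" where
  "letter (FinWord us) i = us ! (i - 1)"
| "letter (InfWord f) i = f (i - 1)"

definition W0 :: "'a topology \<Rightarrow> 'a gword set" where
  "W0 X = FinWord ` {us. set us \<subseteq> topspace X} \<union> InfWord ` {f. range f \<subseteq> topspace X}"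

text \<open>
  The one-point compactification lives on \<open>'a option\<close>, with \<open>None\<close> as the point at infinity.
  The factors of the countable power are indexed by \<open>nat\<close>, the first one having index 0.
\<close>

definition sequence_space :: "'a topology \<Rightarrow> (nat \<Rightarrow> 'a option) topology" where
  "sequence_space X = product_topology (\<lambda>_. Alexandroff_compactification X) UNIV"

definition Q :: "(nat \<Rightarrow> 'a option) \<Rightarrow> 'a gword" where
  "Q y = (if \<exists>n. y n = None
          then FinWord (map (\<lambda>i. the (y i)) [0..<(LEAST n. y n = None)])
          else InfWord (\<lambda>i. the (y i)))"

definition W0_topology :: "'a topology \<Rightarrow> 'a gword topology" where
  "W0_topology X = topology (\<lambda>U. U \<subseteq> W0 X \<and>
     openin (sequence_space X) {y \<in> topspace (sequence_space X). Q y \<in> U})"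

lemma openin_W0_topology:
  "openin (W0_topology X) U \<longleftrightarrow>
     U \<subseteq> W0 X \<and> openin (sequence_space X) {y \<in> topspace (sequence_space X). Q y \<in> U}"
proof -
  let ?S = "sequence_space X"
  let ?P = "\<lambda>U. {y \<in> topspace ?S. Q y \<in> U}"
  have "istopology (\<lambda>U. U \<subseteq> W0 X \<and> openin ?S (?P U))"
    unfolding istopology_def
  proof (intro conjI allI impI; (elim conjE)?)
    fix A B
    assume "openin ?S (?P A)" "openin ?S (?P B)"
    then have "openin ?S (?P A \<inter> ?P B)" by blast
    also have "?P A \<inter> ?P B = ?P (A \<inter> B)" by blast
    finally show "openin ?S (?P (A \<inter> B))" .
  next
    fix K
    assume "\<forall>U\<in>K. U \<subseteq> W0 X \<and> openin ?S (?P U)"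
    then have "openin ?S (\<Union> (?P ` K))" by blast
    also have "\<Union> (?P ` K) = ?P (\<Union> K)" by blast
    finally show "openin ?S (?P (\<Union> K))" .
  qed blast+
  then show ?thesis
    by (simp add: W0_topology_def)
qed

lemma topspace_sequence_space:
  "topspace (sequence_space X) = {y. \<forall>n. y n = None \<or> y n \<in> Some ` topspace X}"
  by (auto simp: sequence_space_def PiE_iff)

lemma Q_image: "Q ` topspace (sequence_space X) = W0 X"
proof (intro subset_antisym subsetI)
  fix w assume "w \<in> Q ` topspace (sequence_space X)"
  then obtain y where w: "w = Q y" and y: "\<And>n. y n = None \<or> y n \<in> Some ` topspace X"
    by (auto simp: topspace_sequence_space)
  have the_in: "the (y i) \<in> topspace X" if "y i \<noteq> None" for i
    using y[of i] that by auto
  show "w \<in> W0 X"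
  proof (cases "\<exists>n. y n = None")
    case True
    let ?us = "map (\<lambda>i. the (y i)) [0..<(LEAST n. y n = None)]"
    have "the (y i) \<in> topspace X" if "i < (LEAST n. y n = None)" for i
      using the_in[OF not_less_Least[OF that]] .
    then have "set ?us \<subseteq> topspace X"
      unfolding set_map set_upt by (intro image_subsetI) simp
    moreover have "w = FinWord ?us"
      using True by (simp add: w Q_def)
    ultimately show ?thesis
      unfolding W0_def by blast
  next
    case False
    then have "range (\<lambda>i. the (y i)) \<subseteq> topspace X"
      using the_in by blast
    moreover have "w = InfWord (\<lambda>i. the (y i))"
      using False by (simp add: w Q_def)
    ultimately show ?thesis
      unfolding W0_def by blast
  qed
next
  fix w assume "w \<in> W0 X"
  then consider us where "w = FinWord us" "set us \<subseteq> topspace X"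
    | f where "w = InfWord f" "range f \<subseteq> topspace X"
    unfolding W0_def by blast
  then show "w \<in> Q ` topspace (sequence_space X)"
  proof cases
    case 1
    define y where "y i = (if i < length us then Some (us ! i) else None)" for i
    have "(LEAST n. y n = None) = length us"
      by (rule Least_equality) (auto simp: y_def not_less split: if_splits)
    moreover have "\<exists>n. y n = None"
      by (auto simp: y_def)
    ultimately have "Q y = FinWord (map (\<lambda>i. the (y i)) [0..<length us])"
      by (simp add: Q_def)
    also have "map (\<lambda>i. the (y i)) [0..<length us] = us"
      by (rule nth_equalityI) (auto simp: y_def)
    finally have "Q y = w" using 1 by simp
    moreover have "y \<in> topspace (sequence_space X)"
      unfolding topspace_sequence_space y_def using 1(2) by (auto dest: nth_mem)
    ultimately show ?thesis by blast
  next
    case 2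
    have "Q (\<lambda>i. Some (f i)) = w" using 2 by (simp add: Q_def)
    moreover have "(\<lambda>i. Some (f i)) \<in> topspace (sequence_space X)"
      using 2 by (auto simp: topspace_sequence_space)
    ultimately show ?thesis by blast
  qed
qed

lemma topspace_W0_topology: "topspace (W0_topology X) = W0 X"
proof (rule subset_antisym)
  show "topspace (W0_topology X) \<subseteq> W0 X"
    using openin_W0_topology openin_topspace by blast
  have "{y \<in> topspace (sequence_space X). Q y \<in> W0 X} = topspace (sequence_space X)"
    using Q_image by blast
  then show "W0 X \<subseteq> topspace (W0_topology X)"
    by (intro openin_subset) (simp add: openin_W0_topology)
qed

lemma quotient_map_Q: "quotient_map (sequence_space X) (W0_topology X) Q"
  by (simp add: quotient_map_def topspace_W0_topology Q_image openin_W0_topology)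

text \<open>
  The filter along which a subsequence $(\cdot)_{n:\, \ell(x^n) \ge i}$ is required to converge:
  a property holds eventually iff it holds for all but finitely many $n$ with $\ell(x^n) \ge i$.
  If there are only finitely many such $n$ this filter is trivial, so that every limit exists.
\<close>

definition longer :: "(nat \<Rightarrow> 'a gword) \<Rightarrow> nat \<Rightarrow> nat filter" where
  "longer xs i = inf sequentially (principal {n. enat i \<le> wlength (xs n)})"

end

(* With a word padded by infinity = None, each coordinate of padded words is continuous at x up to and
   including position l(x), because the generalized cylinders have open preimage under Q. Conversely, if
   these coordinates converge, then x^n -> x: for infinite x because Q is continuous, and for finite x by
   compactness of the sequence space, which makes the coordinates beyond l(x) irrelevant. Convergence of
   a padded coordinate to a letter encodes both that the words are eventually long enough and
   that their letters converge; convergence at position l(x) is the escape to infinity. *)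

theory Submission
  imports Defs
begin

section \<open>Canonical representatives of words in the sequence space\<close>

text \<open>A section of the quotient map \<open>Q\<close>. Positions count from 0, so position
  \<open>i\<close> holds the letter with number \<open>i + 1\<close>, and the first
  \<open>None\<close> stands at position \<open>wlength w\<close>.\<close>

definition padded :: "'a gword \<Rightarrow> nat \<Rightarrow> 'a option" where
  "padded w i = (if enat i < wlength w then Some (letter w (Suc i)) else None)"

lemma padded_eq_None_iff: "padded w i = None \<longleftrightarrow> wlength w \<le> enat i"
  by (auto simp: padded_def)

lemma enat_le_wlength_iff: "enat m \<le> wlength w \<longleftrightarrow> (\<forall>i<m. padded w i \<noteq> None)"
proof (cases m)
  case (Suc n)
  have "(\<forall>i<Suc n. enat i < wlength w) \<longleftrightarrow> enat n < wlength w"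
    by (cases "wlength w") (auto intro: less_trans)
  then show ?thesis
    by (simp add: Suc padded_eq_None_iff not_le Suc_ile_eq)
qed (simp flip: zero_enat_def)

lemma letter_in_topspace:
  assumes "w \<in> W0 X" "enat i < wlength w"
  shows "letter w (Suc i) \<in> topspace X"
  using assms unfolding W0_def by (auto dest: nth_mem)

lemma padded_in_topspace:
  assumes "w \<in> W0 X"
  shows "padded w \<in> topspace (sequence_space X)"
  using letter_in_topspace[OF assms] by (auto simp: topspace_sequence_space padded_def)

lemma Q_padded: "Q (padded w) = w"
proof (cases w)
  case (FinWord us)
  have "(LEAST n. padded w n = None) = length us"
    by (rule Least_equality) (auto simp: padded_eq_None_iff FinWord)
  moreover have "\<exists>n. padded w n = None"
    by (auto simp: padded_eq_None_iff FinWord)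
  ultimately show ?thesis
    by (auto simp: Q_def FinWord padded_def intro: nth_equalityI)
next
  case (InfWord f)
  then show ?thesis
    by (simp add: Q_def padded_def)
qed

text \<open>\<open>Q\<close> cuts a sequence at its first \<open>None\<close>, so padding the
  resulting word again erases whatever stood behind that position. This describes the fibres of
  \<open>Q\<close>.\<close>

lemma padded_Q: "padded (Q y) i = (if \<forall>j\<le>i. y j \<noteq> None then y i else None)"
proof (cases "\<exists>n. y n = None")
  case True
  define m where "m = (LEAST n. y n = None)"
  have m: "y m = None"
    unfolding m_def using True by (rule LeastI_ex)
  have less_m: "y j \<noteq> None" if "j < m" for j
    using not_less_Least that unfolding m_def by blast
  have Q: "Q y = FinWord (map (\<lambda>i. the (y i)) [0..<m])"
    using True by (simp add: Q_def m_def)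
  show ?thesis
  proof (cases "i < m")
    case True
    then have "\<forall>j\<le>i. y j \<noteq> None"
      using less_m by simp
    with True show ?thesis
      by (simp add: Q padded_def)
  next
    case False
    with m have "\<not> (\<forall>j\<le>i. y j \<noteq> None)"
      by (auto simp: not_less)
    moreover have "padded (Q y) i = None"
      using False by (simp add: Q padded_eq_None_iff)
    ultimately show ?thesis
      by (simp only: if_False)
  qed
next
  case False
  then have "y n = Some (the (y n))" for n
    by (simp del: not_None_eq)
  moreover have "Q y = InfWord (\<lambda>i. the (y i))"
    using False by (simp only: Q_def if_False)
  then have "padded (Q y) i = Some (the (y i))"
    by (simp add: padded_def)
  ultimately show ?thesis
    using False by (simp del: not_None_eq)
qed

text \<open>Agreement at position \<open>k\<close> itself is essential: it puts a
  \<open>None\<close> into \<open>y\<close> there, and \<open>Q\<close> ignores everything behind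
  it.\<close>

lemma Q_eqI:
  assumes len: "wlength x = enat k" and eq: "\<And>i. i \<le> k \<Longrightarrow> y i = padded x i"
  shows "Q y = x"
proof -
  have "padded (Q y) i = padded x i" for i
  proof (cases "\<forall>j\<le>i. y j \<noteq> None")
    case True
    have "y k = None"
      using eq[of k] len by (simp add: padded_eq_None_iff)
    with True have "i < k"
      by (meson not_le)
    with True eq[of i] show ?thesis
      by (simp add: padded_Q)
  next
    case False
    then obtain j where j: "j \<le> i" "y j = None"
      by blast
    have "wlength x \<le> enat i"
    proof (cases "j \<le> k")
      case True
      with eq[OF True] j have "wlength x \<le> enat j"
        by (simp flip: padded_eq_None_iff)
      with j(1) show ?thesis
        by (meson enat_ord_simps(1) order_trans)
    qed (use j len in simp)
    then have "padded x i = None"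
      by (simp add: padded_eq_None_iff)
    with False show ?thesis
      by (simp only: padded_Q if_False)
  qed
  then have "padded (Q y) = padded x"
    by blast
  then show ?thesis
    by (metis Q_padded)
qed

section \<open>Coordinates and open cylinders\<close>

lemma continuous_map_coordinate:
  "continuous_map (sequence_space X) (Alexandroff_compactification X) (\<lambda>y. y i)"
  unfolding sequence_space_def by (rule continuous_map_product_projection) simp

text \<open>The preimage under \<open>Q\<close> constrains only the coordinates up to
  \<open>m\<close>: the earlier ones avoid \<open>None\<close>, and coordinate \<open>m\<close> lies
  in \<open>G\<close>. If \<open>None\<close> is in \<open>G\<close>, words of length exactly
  \<open>m\<close> belong to the set, as in the generalized cylinders.\<close>

lemma openin_cylinder:
  assumes G: "openin (Alexandroff_compactification X) G"
  shows "openin (W0_topology X) {w \<in> W0 X. enat m \<le> wlength w \<and> padded w m \<in> G}"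
proof -
  let ?S = "sequence_space X" and ?A = "Alexandroff_compactification X"
  have "openin ?A (Some ` topspace X)"
    by simp
  then have "openin ?S {y \<in> topspace ?S. y j \<in> Some ` topspace X}" for j
    by (rule openin_continuous_map_preimage[OF continuous_map_coordinate])
  moreover have "{y \<in> topspace ?S. y j \<noteq> None} = {y \<in> topspace ?S. y j \<in> Some ` topspace X}" for j
    by (auto simp: topspace_sequence_space) (metis option.distinct(1))
  ultimately have open_not_None: "openin ?S {y \<in> topspace ?S. y j \<noteq> None}" for j
    by simp
  have "openin ?S {y \<in> topspace ?S. y m \<in> G}"
    using G by (rule openin_continuous_map_preimage[OF continuous_map_coordinate])
  then have "openin ?S ({y \<in> topspace ?S. y m \<in> G} \<inter> (\<Inter>j<m. {y \<in> topspace ?S. y j \<noteq> None}))"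
    by (rule openin_Int_Inter[rotated]) (use open_not_None in auto)
  moreover have "{y \<in> topspace ?S. y m \<in> G} \<inter> (\<Inter>j<m. {y \<in> topspace ?S. y j \<noteq> None}) =
      {y \<in> topspace ?S. Q y \<in> {w \<in> W0 X. enat m \<le> wlength w \<and> padded w m \<in> G}}"
  proof -
    have "padded (Q y) i \<noteq> None \<longleftrightarrow> (\<forall>j\<le>i. y j \<noteq> None)" for y :: "nat \<Rightarrow> 'a option" and i
      by (simp only: padded_Q split: if_split) blast
    then have len: "enat m \<le> wlength (Q y) \<longleftrightarrow> (\<forall>j<m. y j \<noteq> None)" for y :: "nat \<Rightarrow> 'a option"
      unfolding enat_le_wlength_iff by (meson le_less_trans order_refl)
    \<comment> \<open>Only the positions before \<open>m\<close> have to carry letters; if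
      \<open>y m\<close> is \<open>None\<close>, both sides are \<open>None\<close>.\<close>
    have "padded (Q y) m = y m" if "\<forall>j<m. y j \<noteq> None" for y :: "nat \<Rightarrow> 'a option"
      using that by (auto simp: padded_Q le_less)
    moreover have "Q y \<in> W0 X" if "y \<in> topspace ?S" for y
      using that Q_image by blast
    ultimately show ?thesis
      by (auto simp: len simp del: not_None_eq)
  qed
  ultimately show ?thesis
    unfolding openin_W0_topology by auto
qed

section \<open>Convergence of words through padded coordinates\<close>

text \<open>
  The letters after position \<open>k + 1\<close> are unconstrained, so the padded words
  need not converge. Overwriting these coordinates by \<open>None\<close> is a closed map of the compact Hausdorff
  sequence space into itself, whose fibre over \<open>padded x\<close> lies in the fibre of \<open>Q\<close> over \<open>x\<close>.
\<close>

lemma limitin_W0_if_padded_finite: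
  assumes X: "locally_compact_space X" "Hausdorff_space X"
    and xs: "\<And>n. xs n \<in> W0 X" and x: "x \<in> W0 X" and len: "wlength x = enat k"
    and lim: "\<And>m. m \<le> k \<Longrightarrow>
      limitin (Alexandroff_compactification X) (\<lambda>n. padded (xs n) m) (padded x m) F"
  shows "limitin (W0_topology X) xs x F"
  unfolding limitin_def topspace_W0_topology
proof (intro conjI allI impI x; elim conjE)
  let ?S = "sequence_space X" and ?A = "Alexandroff_compactification X"
  define T where "T y i = (if i \<le> k then y i else None)" for y :: "nat \<Rightarrow> 'a option" and i
  fix U assume U: "openin (W0_topology X) U" "x \<in> U"
  define C where "C = topspace ?S - {y \<in> topspace ?S. Q y \<in> U}"
  have "closedin ?S C"
    using U(1) unfolding C_def openin_W0_topology by blast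
  have "continuous_map ?S ?A (\<lambda>y. T y i)" for i
    by (cases "i \<le> k") (simp_all add: T_def continuous_map_coordinate)
  then have "continuous_map ?S ?S T"
    unfolding sequence_space_def continuous_map_componentwise_UNIV by blast
  \<comment> \<open>The hypotheses on \<open>X\<close> enter here: they make the one-point
    compactification Hausdorff, and hence also its countable power.\<close>
  moreover have "compact_space ?S" "Hausdorff_space ?S"
    using X by (simp_all add: sequence_space_def compact_space_product_topology
        Hausdorff_space_product_topology Hausdorff_space_Alexandroff_compactification)
  ultimately have "closed_map ?S ?S T"
    by (simp add: continuous_imp_closed_map_gen Hausdorff_imp_kc_space)
  with \<open>closedin ?S C\<close> have "closedin ?S (T ` C)"
    by (simp add: closed_map_def)
  then have "openin ?S (topspace ?S - T ` C)"
    by blast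
  moreover have "padded x \<in> topspace ?S - T ` C"
  proof -
    have "Q y = x" if "padded x = T y" for y
      using len by (rule Q_eqI) (simp add: that T_def)
    then show ?thesis
      using U(2) padded_in_topspace[OF x] by (auto simp: C_def)
  qed
  moreover have "limitin ?S (\<lambda>n. T (padded (xs n))) (padded x) F"
  proof -
    have "limitin ?A (\<lambda>n. T (padded (xs n)) i) (padded x i) F" for i
    proof (cases "i \<le> k")
      case False
      then have "padded x i = None"
        by (simp add: padded_eq_None_iff len)
      with False show ?thesis
        by (simp add: T_def)
    qed (simp add: T_def lim)
    moreover have "T (padded (xs n)) \<in> topspace ?S" for n
      using padded_in_topspace[OF xs] by (auto simp: topspace_sequence_space T_def)
    ultimately show ?thesis
      unfolding sequence_space_def limitin_componentwise by (simp add: PiE_iff)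
  qed
  ultimately have "\<forall>\<^sub>F n in F. T (padded (xs n)) \<in> topspace ?S - T ` C"
    unfolding limitin_def by blast
  \<comment> \<open>The neighbourhood of \<open>padded x\<close> misses \<open>T\<close> applied to
    \<open>C\<close>, so a sequence that \<open>T\<close> sends into it cannot lie in
    \<open>C\<close>.\<close>
  then show "\<forall>\<^sub>F n in F. xs n \<in> U"
  proof (rule eventually_mono)
    fix n assume "T (padded (xs n)) \<in> topspace ?S - T ` C"
    then have "padded (xs n) \<notin> C"
      by blast
    then show "xs n \<in> U"
      using padded_in_topspace[OF xs] by (simp add: C_def Q_padded)
  qed
qed

text \<open>With every coordinate under control, the padded words converge in the product, and
  \<open>Q\<close> carries their limit to \<open>Q (padded x)\<close>, which is
  \<open>x\<close>.\<close>

lemma limitin_W0_if_padded_infinite: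
  assumes xs: "\<And>n. xs n \<in> W0 X"
    and lim: "\<And>m. limitin (Alexandroff_compactification X) (\<lambda>n. padded (xs n) m) (padded x m) F"
  shows "limitin (W0_topology X) xs x F"
proof -
  have "limitin (sequence_space X) (\<lambda>n. padded (xs n)) (padded x) F"
    using lim padded_in_topspace[OF xs]
    unfolding sequence_space_def limitin_componentwise by simp
  with quotient_imp_continuous_map[OF quotient_map_Q]
  have "limitin (W0_topology X) (Q \<circ> (\<lambda>n. padded (xs n))) (Q (padded x)) F"
    by (rule continuous_map_limit)
  then show ?thesis
    by (simp add: o_def Q_padded)
qed

lemma limitin_W0_iff_padded:
  assumes X: "locally_compact_space X" "Hausdorff_space X"
    and xs: "\<And>n. xs n \<in> W0 X" and x: "x \<in> W0 X"
  shows "limitin (W0_topology X) xs x F \<longleftrightarrow>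
    (\<forall>m. enat m \<le> wlength x \<longrightarrow>
      limitin (Alexandroff_compactification X) (\<lambda>n. padded (xs n) m) (padded x m) F)"
proof (intro iffI allI impI)
  fix m assume lim: "limitin (W0_topology X) xs x F" and m: "enat m \<le> wlength x"
  show "limitin (Alexandroff_compactification X) (\<lambda>n. padded (xs n) m) (padded x m) F"
    unfolding limitin_def
  proof (intro conjI allI impI; (elim conjE)?)
    show "padded x m \<in> topspace (Alexandroff_compactification X)"
      using padded_in_topspace[OF x] by (auto simp: topspace_sequence_space)
  next
    \<comment> \<open>The cylinder over \<open>G\<close> at position \<open>m\<close> is a
      neighbourhood of \<open>x\<close> because \<open>m\<close> does not exceed the length of
      \<open>x\<close>.\<close>
    fix G assume "openin (Alexandroff_compactification X) G" "padded x m \<in> G"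
    with lim openin_cylinder x m
    have "\<forall>\<^sub>F n in F. xs n \<in> {w \<in> W0 X. enat m \<le> wlength w \<and> padded w m \<in> G}"
      unfolding limitin_def by blast
    then show "\<forall>\<^sub>F n in F. padded (xs n) m \<in> G"
      by (rule eventually_mono) simp
  qed
next
  assume lim: "\<forall>m. enat m \<le> wlength x \<longrightarrow>
    limitin (Alexandroff_compactification X) (\<lambda>n. padded (xs n) m) (padded x m) F"
  show "limitin (W0_topology X) xs x F"
  proof (cases "wlength x")
    case (enat k)
    with lim show ?thesis
      by (intro limitin_W0_if_padded_finite[OF X xs x]) auto
  next
    case infinity
    with lim show ?thesis
      by (intro limitin_W0_if_padded_infinite[OF xs]) auto
  qed
qed

section \<open>From padded coordinates to letters and lengths\<close>

lemma eventually_longer: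
  "eventually P (longer xs i) \<longleftrightarrow> (\<forall>\<^sub>F n in sequentially. enat i \<le> wlength (xs n) \<longrightarrow> P n)"
  by (simp add: longer_def eventually_inf_principal)

text \<open>The copy of \<open>X\<close> is open in the compactification and carries the topology of
  \<open>X\<close>; a limit in it therefore forces the coordinate to be a letter eventually.\<close>

lemma limitin_padded_Some_iff:
  assumes "enat m < wlength x"
  shows "limitin (Alexandroff_compactification X) (\<lambda>n. padded (xs n) m) (padded x m) sequentially \<longleftrightarrow>
    (\<forall>\<^sub>F n in sequentially. enat (Suc m) \<le> wlength (xs n)) \<and>
    limitin X (\<lambda>n. letter (xs n) (Suc m)) (letter x (Suc m)) (longer xs (Suc m))"
    (is "limitin ?A ?p _ _ \<longleftrightarrow> ?len \<and> limitin X ?l ?a ?L")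
proof -
  have p: "padded x m = Some ?a"
    using assms by (simp add: padded_def)
  have p_Some: "?p n = Some (?l n)" if "enat (Suc m) \<le> wlength (xs n)" for n
    using that by (simp add: padded_def Suc_ile_eq)
  have p_None: "?p n = None" if "\<not> enat (Suc m) \<le> wlength (xs n)" for n
    using that by (simp add: padded_def Suc_ile_eq)
  show ?thesis
    unfolding p
  proof (intro iffI conjI)
    assume lim: "limitin ?A ?p (Some ?a) sequentially"
    have a: "?a \<in> topspace X"
      using lim by (auto simp: limitin_def)
    have ev: "\<forall>\<^sub>F n in sequentially. ?p n \<in> Some ` V" if "openin X V" "?a \<in> V" for V
      using lim that by (simp add: limitin_def)
    show ?len
      \<comment> \<open>With the whole space as \<open>V\<close>, the coordinate is eventually not
        \<open>None\<close>, so the word reaches this position.\<close>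
      using ev[OF openin_topspace a] by (rule eventually_mono) (use p_None in fastforce)
    show "limitin X ?l ?a ?L"
      unfolding limitin_def eventually_longer
    proof (intro conjI allI impI a; elim conjE)
      fix V assume "openin X V" "?a \<in> V"
      from ev[OF this]
      show "\<forall>\<^sub>F n in sequentially. enat (Suc m) \<le> wlength (xs n) \<longrightarrow> ?l n \<in> V"
        by (rule eventually_mono) (use p_Some in fastforce)
    qed
  next
    assume R: "?len \<and> limitin X ?l ?a ?L"
    then have lim: "limitin ?A (Some \<circ> ?l) (Some ?a) ?L"
      by (intro continuous_map_limit[OF continuous_map_Some]) blast
    show "limitin ?A ?p (Some ?a) sequentially"
      unfolding limitin_def
    proof (intro conjI allI impI; (elim conjE)?)
      fix G assume "openin ?A G" "Some ?a \<in> G"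
      with lim have "\<forall>\<^sub>F n in sequentially. enat (Suc m) \<le> wlength (xs n) \<longrightarrow> Some (?l n) \<in> G"
        by (simp add: limitin_def eventually_longer)
      \<comment> \<open>The length condition holds eventually, so the restriction to long words
        disappears.\<close>
      with R[THEN conjunct1] show "\<forall>\<^sub>F n in sequentially. ?p n \<in> G"
        by eventually_elim (simp add: p_Some)
    qed (use lim in \<open>simp add: limitin_def\<close>)
  qed
qed

text \<open>Words ending by position \<open>k\<close> have \<open>None\<close> there, which lies in
  every neighbourhood of infinity; only the longer words impose a condition.\<close>

lemma limitin_padded_None_iff:
  assumes "wlength x = enat k"
  shows "limitin (Alexandroff_compactification X) (\<lambda>n. padded (xs n) k) (padded x k) sequentially \<longleftrightarrow>
    limitin (Alexandroff_compactification X) (\<lambda>n. Some (letter (xs n) (Suc k))) None (longer xs (Suc k))"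
proof -
  have p: "padded x k = None"
    using assms by (simp add: padded_def)
  have "padded (xs n) k \<in> G \<longleftrightarrow>
      (enat (Suc k) \<le> wlength (xs n) \<longrightarrow> Some (letter (xs n) (Suc k)) \<in> G)" if "None \<in> G" for G n
    using that by (simp add: padded_def Suc_ile_eq)
  then show ?thesis
    by (simp add: p limitin_def eventually_longer)
qed

text \<open>The filter is trivial here. This accounts for the clause in the theorem about infinitely
  many long words.\<close>

lemma limitin_longer_if_finite:
  assumes "l \<in> topspace Y" "finite {n. enat i \<le> wlength (xs n)}"
  shows "limitin Y f l (longer xs i)"
proof -
  have "\<forall>\<^sub>F n in sequentially. \<not> enat i \<le> wlength (xs n)"
    using assms(2) by (simp add: eventually_cofinite flip: cofinite_eq_sequentially)
  then show ?thesis
    using assms(1) unfolding limitin_def eventually_longer by (auto elim: eventually_mono)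
qed

text \<open>Nothing exceeds infinity, so only lower bounds matter; the strict bound by
  \<open>m\<close> is written with \<open>Suc m\<close> to match the condition that letter
  \<open>m + 1\<close> exists.\<close>

lemma tendsto_enat_infinity_iff:
  fixes f :: "'b \<Rightarrow> enat"
  shows "(f \<longlongrightarrow> \<infinity>) F \<longleftrightarrow> (\<forall>m. \<forall>\<^sub>F n in F. enat (Suc m) \<le> f n)"
proof -
  have "(\<forall>a<\<infinity>. \<forall>\<^sub>F n in F. a < f n) \<longleftrightarrow> (\<forall>m. \<forall>\<^sub>F n in F. enat m < f n)"
    by (auto elim!: less_infinityE)
  then show ?thesis
    by (simp add: order_tendsto_iff Suc_ile_eq)
qed

section \<open>Assembling the two characterizations\<close>

theorem corollary2p10:
  fixes X :: "'a topology"
    and \<B> :: "'a set set"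
    and xs :: "nat \<Rightarrow> 'a gword"
    and x :: "'a gword"
  assumes "infinite (topspace X)"
    and "locally_compact_space X"
    and "Hausdorff_space X"
    and "countable \<B>"
    and "\<forall>V\<in>\<B>. openin X V \<and> compactin X V"
    and "\<forall>U p. openin X U \<and> p \<in> U \<longrightarrow> (\<exists>V\<in>\<B>. p \<in> V \<and> V \<subseteq> U)"
    and "\<forall>U\<in>\<B>. \<forall>V\<in>\<B>. U \<inter> V \<in> \<B>"
    and "\<forall>n. xs n \<in> W0 X"
    and "x \<in> W0 X"
  shows "(\<forall>k::nat. wlength x = enat k \<longrightarrow>
            (limitin (W0_topology X) xs x sequentially \<longleftrightarrow>
               (\<exists>N. \<forall>n\<ge>N. enat k \<le> wlength (xs n)) \<and>
               (\<forall>i\<in>{1..k}. limitin X (\<lambda>n. letter (xs n) i) (letter x i) (longer xs i)) \<and>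
               (infinite {n. enat (k + 1) \<le> wlength (xs n)} \<longrightarrow>
                  limitin (Alexandroff_compactification X)
                    (\<lambda>n. Some (letter (xs n) (k + 1))) None (longer xs (k + 1)))))
       \<and> (wlength x = \<infinity> \<longrightarrow>
            (limitin (W0_topology X) xs x sequentially \<longleftrightarrow>
               ((\<lambda>n. wlength (xs n)) \<longlonglongrightarrow> \<infinity>) \<and>
               (\<forall>i\<ge>1. limitin X (\<lambda>n. letter (xs n) i) (letter x i) (longer xs i))))"
proof (intro conjI allI impI)
  let ?A = "Alexandroff_compactification X"
  have key: "limitin (W0_topology X) xs x sequentially \<longleftrightarrow>
      (\<forall>m. enat m \<le> wlength x \<longrightarrow> limitin ?A (\<lambda>n. padded (xs n) m) (padded x m) sequentially)"
    using assms by (intro limitin_W0_iff_padded) auto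
  let ?len = "\<lambda>i. \<forall>\<^sub>F n in sequentially. enat i \<le> wlength (xs n)"
  let ?conv = "\<lambda>i. limitin X (\<lambda>n. letter (xs n) i) (letter x i) (longer xs i)"
  {
    fix k assume k: "wlength x = enat k"
    let ?tail = "limitin ?A (\<lambda>n. Some (letter (xs n) (k + 1))) None (longer xs (k + 1))"
    have "limitin (W0_topology X) xs x sequentially \<longleftrightarrow>
        (\<forall>m<k. limitin ?A (\<lambda>n. padded (xs n) m) (padded x m) sequentially) \<and>
        limitin ?A (\<lambda>n. padded (xs n) k) (padded x k) sequentially"
      unfolding key k by (auto simp: le_less)
    also have "\<dots> \<longleftrightarrow> (\<forall>m<k. ?len (Suc m) \<and> ?conv (Suc m)) \<and> ?tail"
      by (simp add: limitin_padded_Some_iff limitin_padded_None_iff k)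
    \<comment> \<open>Reaching position \<open>k\<close> implies reaching all earlier ones, so one
      length condition suffices; for \<open>k = 0\<close> it holds trivially.\<close>
    also have "\<dots> \<longleftrightarrow> ?len k \<and> (\<forall>m<k. ?conv (Suc m)) \<and> ?tail"
    proof -
      have "?len i" if "?len k" "i \<le> k" for i
        using that(1) by (rule eventually_mono) (meson that(2) enat_ord_simps(1) order_trans)
      moreover have "?len k" if "\<forall>m<k. ?len (Suc m)"
        using that by (cases k) (auto simp flip: zero_enat_def)
      ultimately show ?thesis
        by (meson Suc_leI)
    qed
    also have "(\<forall>m<k. ?conv (Suc m)) \<longleftrightarrow> (\<forall>i\<in>{1..k}. ?conv i)"
      by (fastforce simp: less_eq_Suc_le dest: Suc_le_D)
    also have "?len k \<longleftrightarrow> (\<exists>N. \<forall>n\<ge>N. enat k \<le> wlength (xs n))"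
      by (rule eventually_sequentially)
    \<comment> \<open>If only finitely many words are longer than \<open>k\<close>, the tail
      condition holds automatically.\<close>
    also have "?tail \<longleftrightarrow> (infinite {n. enat (k + 1) \<le> wlength (xs n)} \<longrightarrow> ?tail)"
      using limitin_longer_if_finite[of None ?A] by auto
    finally show "limitin (W0_topology X) xs x sequentially \<longleftrightarrow>
        (\<exists>N. \<forall>n\<ge>N. enat k \<le> wlength (xs n)) \<and> (\<forall>i\<in>{1..k}. ?conv i) \<and>
        (infinite {n. enat (k + 1) \<le> wlength (xs n)} \<longrightarrow> ?tail)" .
  next
    assume inf: "wlength x = \<infinity>"
    have "limitin (W0_topology X) xs x sequentially \<longleftrightarrow> (\<forall>m. ?len (Suc m) \<and> ?conv (Suc m))"
      by (simp add: key inf limitin_padded_Some_iff)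
    also have "\<dots> \<longleftrightarrow> ((\<lambda>n. wlength (xs n)) \<longlonglongrightarrow> \<infinity>) \<and> (\<forall>m. ?conv (Suc m))"
      by (auto simp: tendsto_enat_infinity_iff)
    also have "(\<forall>m. ?conv (Suc m)) \<longleftrightarrow> (\<forall>i\<ge>1. ?conv i)"
      by (fastforce dest: Suc_le_D)
    finally show "limitin (W0_topology X) xs x sequentially \<longleftrightarrow>
        ((\<lambda>n. wlength (xs n)) \<longlonglongrightarrow> \<infinity>) \<and> (\<forall>i\<ge>1. ?conv i)" .
  }
qed

end
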